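(* For every integer $n>1$, $$r_3(\mathbb{Z}_4^n)\ \geq\ \max_{0\leq t\leq n}\ \sum_{i=t+1}^n \binom{n}{i}\,C(i,i-t),$$ where $t$ ranges over integers.
   Context: $\mathbb{Z}_m^n$ denotes the additive group $(\mathbb{Z}/m\mathbb{Z})^n$. A proper arithmetic progression of length $k$ in $\mathbb{Z}_m^n$ is a sequence $x, x+d, \ldots, x+(k-1)d$ (with $x,d\in\mathbb{Z}_m^n$) whose $k$ elements are pairwise distinct. $r_k(\mathbb{Z}_m^n)$ denotes the maximal size of a set $S\subseteq\mathbb{Z}_m^n$ that does not contain a proper arithmetic progression of length $k$. $C(m,d)$ denotes the largest possible size of a (possibly non-linear) binary code in $\mathbb{F}_2^m$ with minimum Hamming distance at least $d$, i.e. the largest size of a subset of $\mathbb{F}_2^m$ any two distinct elements of which differ in at least $d$ coordinates. *)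

theory Defs
  imports "HOL-Algebra.Elementary_Groups" "HOL-Algebra.Product_Groups"
begin

text \<open>The additive group \<open>(\<int>/m\<int>)\<^sup>n\<close>. Its group operation, componentwise
  addition modulo \<open>m\<close>, is written multiplicatively in HOL-Algebra, so \<open>j\<cdot>d\<close> is written
  as the power \<open>d [^] j\<close>. Vectors are extensional functions on \<open>{..<n}\<close> with values
  in \<open>{0..<m}\<close>.\<close>

definition Zmod_power :: "nat \<Rightarrow> nat \<Rightarrow> (nat \<Rightarrow> int) monoid" where
  "Zmod_power m n = product_group {..<n} (\<lambda>_. integer_mod_group m)"

definition contains_proper_AP :: "('a, 'b) monoid_scheme \<Rightarrow> nat \<Rightarrow> 'a set \<Rightarrow> bool" where
  "contains_proper_AP G k S \<longleftrightarrow>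
     (\<exists>x\<in>carrier G. \<exists>d\<in>carrier G.
        inj_on (\<lambda>j::nat. x \<otimes>\<^bsub>G\<^esub> d [^]\<^bsub>G\<^esub> j) {..<k} \<and>
        (\<forall>j<k. x \<otimes>\<^bsub>G\<^esub> d [^]\<^bsub>G\<^esub> j \<in> S))"

text \<open>\<open>AP_free_max k m n\<close> is \<open>r\<^sub>k(\<int>\<^sub>m\<^sup>n)\<close>, meaningful for \<open>k \<ge> 1\<close> and \<open>m \<ge> 1\<close>
  (then the maximum is over a finite nonempty set).\<close>

definition AP_free_max :: "nat \<Rightarrow> nat \<Rightarrow> nat \<Rightarrow> nat" where
  "AP_free_max k m n =
     Max {card S | S. S \<subseteq> carrier (Zmod_power m n) \<and> \<not> contains_proper_AP (Zmod_power m n) k S}"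

definition hamming_dist :: "nat \<Rightarrow> (nat \<Rightarrow> 'a) \<Rightarrow> (nat \<Rightarrow> 'a) \<Rightarrow> nat" where
  "hamming_dist m x y = card {i. i < m \<and> x i \<noteq> y i}"

text \<open>The largest size \<open>C(m,d)\<close> of a binary code; only the set underlying \<open>F\<^sub>2\<^sup>m\<close>
  matters, so it is taken to be that of \<open>\<int>\<^sub>2\<^sup>m\<close>.\<close>

definition max_code_size :: "nat \<Rightarrow> nat \<Rightarrow> nat" where
  "max_code_size m d =
     Max {card A | A. A \<subseteq> carrier (Zmod_power 2 m) \<and>
                      (\<forall>x\<in>A. \<forall>y\<in>A. x \<noteq> y \<longrightarrow> d \<le> hamming_dist m x y)}"

end

theory Submission imports Defs begin

text \<open>If \<open>x, x + d, x + 2d\<close> is a proper progression in \<open>\<int>\<^sub>4\<^sup>n\<close>, then \<open>x\<close> and \<open>x + 2d\<close> have the same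
  set \<open>A\<close> of odd coordinates and differ exactly on the nonempty set \<open>D\<close> of odd coordinates of \<open>d\<close>,
  while \<open>x + d\<close> is odd exactly on the symmetric difference of \<open>A\<close> and \<open>D\<close>. For each set \<open>A\<close> of more
  than \<open>t\<close> coordinates, take the vectors that vanish off \<open>A\<close> and on \<open>A\<close> spell, with the letters
  1 and 3, a word of an optimal code of length \<open>|A|\<close> and distance \<open>|A| - t\<close>. Then \<open>D \<subseteq> A\<close> and
  \<open>|D| \<ge> |A| - t\<close>, so \<open>x + d\<close> would have at most \<open>t\<close> odd coordinates.\<close>

lemma carrier_Zmod_power:
  assumes "m > 0"
  shows "carrier (Zmod_power m n) = {..<n} \<rightarrow>\<^sub>E {0..<int m}"
  using assms by (simp add: Zmod_power_def carrier_integer_mod_group)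

lemma finite_carrier_Zmod_power:
  assumes "m > 0"
  shows "finite (carrier (Zmod_power m n))"
  by (simp add: carrier_Zmod_power[OF assms] finite_PiE)

lemma mult_Zmod_power_apply:
  assumes "i < n"
  shows "(x \<otimes>\<^bsub>Zmod_power m n\<^esub> y) i = (x i + y i) mod int m"
  using assms by (simp add: Zmod_power_def mult_integer_mod_group)

lemma group_Zmod_power: "group (Zmod_power m n)"
  by (simp add: Zmod_power_def)

text \<open>\<open>Max\<close> is only meaningful on a finite set; all candidate sizes are
  cardinalities of subsets of the finite carrier.\<close>

lemma card_le_AP_free_max:
  assumes "m > 0" "S \<subseteq> carrier (Zmod_power m n)" "\<not> contains_proper_AP (Zmod_power m n) k S"
  shows "card S \<le> AP_free_max k m n"
proof -
  let ?F = "{card S | S. S \<subseteq> carrier (Zmod_power m n) \<and> \<not> contains_proper_AP (Zmod_power m n) k S}"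
  have "?F \<subseteq> card ` Pow (carrier (Zmod_power m n))"
    by auto
  then have "finite ?F"
    by (rule finite_subset) (simp add: finite_carrier_Zmod_power[OF assms(1)])
  then show ?thesis
    unfolding AP_free_max_def using assms(2,3) by (intro Max_ge) auto
qed

lemma max_code_size_attained:
  obtains K where "K \<subseteq> carrier (Zmod_power 2 m)"
    "\<And>x y. x \<in> K \<Longrightarrow> y \<in> K \<Longrightarrow> x \<noteq> y \<Longrightarrow> d \<le> hamming_dist m x y"
    "card K = max_code_size m d"
proof -
  let ?F = "{card A | A. A \<subseteq> carrier (Zmod_power 2 m) \<and>
                      (\<forall>x\<in>A. \<forall>y\<in>A. x \<noteq> y \<longrightarrow> d \<le> hamming_dist m x y)}"
  have "?F \<subseteq> card ` Pow (carrier (Zmod_power 2 m))"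
    by auto
  then have "finite ?F"
    by (rule finite_subset) (simp add: finite_carrier_Zmod_power)
  moreover have "?F \<noteq> {}"
    by blast
  ultimately have "Max ?F \<in> ?F"
    by (rule Max_in)
  then show thesis
    using that unfolding max_code_size_def by auto
qed

text \<open>Properness survives only as \<open>x \<noteq> z\<close>, that is 2d \<noteq> 0; this
  loses nothing, since any coincidence among the three terms forces 2d = 0.\<close>

lemma contains_proper_3_AP_Zmod4E:
  assumes "contains_proper_AP (Zmod_power 4 n) 3 S"
  obtains x y z d where "x \<in> S" "y \<in> S" "z \<in> S" "x \<noteq> z"
    "\<And>i. i < n \<Longrightarrow> y i = (x i + d i) mod 4" "\<And>i. i < n \<Longrightarrow> z i = (x i + 2 * d i) mod 4"
proof -
  let ?G = "Zmod_power 4 n"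
  interpret group ?G by (rule group_Zmod_power)
  obtain x d where x: "x \<in> carrier ?G" and d: "d \<in> carrier ?G"
    and inj: "inj_on (\<lambda>j::nat. x \<otimes>\<^bsub>?G\<^esub> d [^]\<^bsub>?G\<^esub> j) {..<3}"
    and mem: "\<And>j::nat. j < 3 \<Longrightarrow> x \<otimes>\<^bsub>?G\<^esub> d [^]\<^bsub>?G\<^esub> j \<in> S"
    using assms unfolding contains_proper_AP_def by blast
  have pow: "x \<otimes>\<^bsub>?G\<^esub> d [^]\<^bsub>?G\<^esub> (0::nat) = x" "x \<otimes>\<^bsub>?G\<^esub> d [^]\<^bsub>?G\<^esub> (1::nat) = x \<otimes>\<^bsub>?G\<^esub> d"
    "x \<otimes>\<^bsub>?G\<^esub> d [^]\<^bsub>?G\<^esub> (2::nat) = x \<otimes>\<^bsub>?G\<^esub> (d \<otimes>\<^bsub>?G\<^esub> d)"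
    using x d by (simp_all add: numeral_2_eq_2)
  show thesis
  proof
    show "x \<in> S" "x \<otimes>\<^bsub>?G\<^esub> d \<in> S" "x \<otimes>\<^bsub>?G\<^esub> (d \<otimes>\<^bsub>?G\<^esub> d) \<in> S"
      using mem[of 0] mem[of 1] mem[of 2] pow by simp_all
    show "x \<noteq> x \<otimes>\<^bsub>?G\<^esub> (d \<otimes>\<^bsub>?G\<^esub> d)"
      using inj_onD[OF inj, of 0 2] pow by auto
    show "(x \<otimes>\<^bsub>?G\<^esub> d) i = (x i + d i) mod 4" if "i < n" for i
      using that by (simp add: mult_Zmod_power_apply)
    show "(x \<otimes>\<^bsub>?G\<^esub> (d \<otimes>\<^bsub>?G\<^esub> d)) i = (x i + 2 * d i) mod 4" if "i < n" for i
      using that by (simp add: mult_Zmod_power_apply mod_add_right_eq)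
  qed
qed

text \<open>\<open>h\<close> numbers the coordinates in \<open>A\<close>, so that a word of length
  \<open>card A\<close> can be read along \<open>A\<close>. Restricting to \<open>{..<n}\<close>
  keeps the vector extensional, as the carrier demands.\<close>

definition spell :: "nat \<Rightarrow> (nat \<Rightarrow> nat) \<Rightarrow> nat set \<Rightarrow> (nat \<Rightarrow> int) \<Rightarrow> nat \<Rightarrow> int" where
  "spell n h A c = (\<lambda>i\<in>{..<n}. if i \<in> A then 1 + 2 * c (h i) else 0)"

lemma odd_spell_iff: "i < n \<Longrightarrow> odd (spell n h A c i) \<longleftrightarrow> i \<in> A"
  by (simp add: spell_def)

text \<open>Since 1 + 2c is odd for every integer c, a spelled vector determines its set
  \<open>A\<close>. Hence different sets contribute disjoint families.\<close>

lemma odd_support_spell: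
  assumes "A \<subseteq> {..<n}"
  shows "{i. i < n \<and> odd (spell n h A c i)} = A"
  using assms by (auto simp: spell_def subset_iff)

lemma spell_in_carrier:
  assumes "bij_betw h A {..<m}" "c \<in> carrier (Zmod_power 2 m)"
  shows "spell n h A c \<in> carrier (Zmod_power 4 n)"
proof -
  have "0 \<le> c (h i) \<and> c (h i) < 2" if "i \<in> A" for i
    using assms that bij_betwE[OF assms(1)]
    by (fastforce simp: carrier_Zmod_power PiE_iff)
  then show ?thesis
    by (fastforce simp: carrier_Zmod_power spell_def PiE_iff)
qed

text \<open>Both vectors vanish off \<open>A\<close> and the map from c to 1 + 2c is injective, so
  \<open>h\<close> carries the coordinates of disagreement onto those of the two words.\<close>

lemma card_spell_diff:
  assumes "A \<subseteq> {..<n}" "bij_betw h A {..<m}"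
  shows "card {i. i < n \<and> spell n h A a i \<noteq> spell n h A b i} = hamming_dist m a b"
proof -
  have "bij_betw h {i\<in>A. a (h i) \<noteq> b (h i)} {j\<in>{..<m}. a j \<noteq> b j}"
    using assms(2) by (auto simp: bij_betw_def inj_on_def)
  then have "card {i\<in>A. a (h i) \<noteq> b (h i)} = card {j\<in>{..<m}. a j \<noteq> b j}"
    by (rule bij_betw_same_card)
  moreover have "{i. i < n \<and> spell n h A a i \<noteq> spell n h A b i} = {i\<in>A. a (h i) \<noteq> b (h i)}"
    using assms(1) by (auto simp: spell_def)
  ultimately show ?thesis
    by (simp add: hamming_dist_def)
qed

lemma spell_inject:
  assumes "A \<subseteq> {..<n}" "bij_betw h A {..<m}"
    "a \<in> carrier (Zmod_power 2 m)" "b \<in> carrier (Zmod_power 2 m)"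
    "spell n h A a = spell n h A b"
  shows "a = b"
proof (rule PiE_ext)
  show "a \<in> {..<m} \<rightarrow>\<^sub>E {0..<int 2}" "b \<in> {..<m} \<rightarrow>\<^sub>E {0..<int 2}"
    using assms(3,4) by (simp_all only: carrier_Zmod_power[OF zero_less_numeral])
  have "hamming_dist m a b = 0"
    using card_spell_diff[OF assms(1,2), of a b] assms(5) by simp
  then show "a j = b j" if "j \<in> {..<m}" for j
    using that by (auto simp: hamming_dist_def)
qed

text \<open>Modulo 4, 2d vanishes exactly when d is even, and \<open>x i\<close> is already reduced,
  so \<open>x\<close> and \<open>z\<close> differ exactly where \<open>d\<close> is odd. The
  assumption \<open>diff\<close> turns the symmetric difference into a set difference.\<close>

lemma odd_support_midpoint:
  fixes n :: nat and x y z d :: "nat \<Rightarrow> int"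
  defines "A \<equiv> {i. i < n \<and> odd (x i)}"
  assumes y: "\<And>i. i < n \<Longrightarrow> y i = (x i + d i) mod 4"
    and z: "\<And>i. i < n \<Longrightarrow> z i = (x i + 2 * d i) mod 4"
    and x: "\<And>i. i < n \<Longrightarrow> x i \<in> {0..<4}"
    and diff: "{i. i < n \<and> x i \<noteq> z i} \<subseteq> A"
  shows "{i. i < n \<and> odd (y i)} = A - {i. i < n \<and> x i \<noteq> z i}"
proof -
  have "odd (y i) \<longleftrightarrow> odd (x i) \<and> x i = z i" if "i < n" for i
  proof -
    have "odd (y i) \<longleftrightarrow> odd (x i + d i)"
      using y[OF that] by presburger
    moreover have "x i = z i \<longleftrightarrow> even (d i)"
      using x[OF that] z[OF that] by simp presburger
    moreover have "odd (x i)" if "x i \<noteq> z i"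
      using that diff \<open>i < n\<close> by (auto simp: A_def)
    ultimately show ?thesis
      by auto
  qed
  then show ?thesis
    by (auto simp: A_def)
qed

lemma AP_free_max_3_4_ge:
  "(\<Sum>i = t + 1..n. (n choose i) * max_code_size i (i - t)) \<le> AP_free_max 3 4 n"
proof -
  \<comment> \<open>One optimal code is fixed for every length \<open>i\<close>. For
    \<open>i \<le> t\<close> truncated subtraction makes the required distance 0, but only lengths
    above \<open>t\<close> enter \<open>S\<close>.\<close>
  have "\<exists>K. K \<subseteq> carrier (Zmod_power 2 i)
      \<and> (\<forall>x\<in>K. \<forall>y\<in>K. x \<noteq> y \<longrightarrow> i - t \<le> hamming_dist i x y) \<and> card K = max_code_size i (i - t)" for i
    by (rule max_code_size_attained[of i "i - t"]) blast
  then obtain K where K: "\<And>i. K i \<subseteq> carrier (Zmod_power 2 i)"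
    and K_dist: "\<And>i x y. x \<in> K i \<Longrightarrow> y \<in> K i \<Longrightarrow> x \<noteq> y \<Longrightarrow> i - t \<le> hamming_dist i x y"
    and K_card: "\<And>i. card (K i) = max_code_size i (i - t)"
    by metis
  \<comment> \<open>The guard \<open>finite A\<close> sits inside the existential so that choice
    yields a numbering \<open>h\<close> total on all sets.\<close>
  have "\<exists>h. finite A \<longrightarrow> bij_betw h A {..<card A}" for A :: "nat set"
    using ex_bij_betw_finite_nat by (metis atLeast0LessThan)
  then obtain h where h: "\<And>A :: nat set. finite A \<Longrightarrow> bij_betw (h A) A {..<card A}"
    by metis
  define \<A> where "\<A> = {A. A \<subseteq> {..<n} \<and> t < card A}"
  define S where "S = (\<Union>A\<in>\<A>. spell n (h A) A ` K (card A))"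
  have \<A>: "A \<subseteq> {..<n}" "t < card A" "bij_betw (h A) A {..<card A}" if "A \<in> \<A>" for A
    using that h finite_subset[of A "{..<n}"] by (auto simp: \<A>_def)
  have "finite \<A>"
    by (rule finite_subset[of _ "Pow {..<n}"]) (auto simp: \<A>_def)
  have K_fin: "finite (K i)" for i
    using K finite_carrier_Zmod_power[of 2] finite_subset by fastforce
  have S_sub: "S \<subseteq> carrier (Zmod_power 4 n)"
    using \<A>(3) K spell_in_carrier unfolding S_def by blast
  have "card S = (\<Sum>A\<in>\<A>. card (spell n (h A) A ` K (card A)))"
    unfolding S_def
  proof (rule card_UN_disjoint[OF \<open>finite \<A>\<close>])
    show "\<forall>A\<in>\<A>. finite (spell n (h A) A ` K (card A))"
      using K_fin by blast
    show "\<forall>A\<in>\<A>. \<forall>B\<in>\<A>. A \<noteq> B \<longrightarrow>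
        spell n (h A) A ` K (card A) \<inter> spell n (h B) B ` K (card B) = {}"
    proof (intro ballI impI equals0I, elim IntE imageE)
      fix A B v a b
      assume "A \<in> \<A>" "B \<in> \<A>" "A \<noteq> B" "v = spell n (h A) A a" "v = spell n (h B) B b"
      then show False
        using odd_support_spell[OF \<A>(1)[of A], of "h A" a] odd_support_spell[OF \<A>(1)[of B], of "h B" b]
        by simp
    qed
  qed
  also have "\<dots> = (\<Sum>A\<in>\<A>. max_code_size (card A) (card A - t))"
  proof (intro sum.cong refl)
    fix A assume "A \<in> \<A>"
    then have "inj_on (spell n (h A) A) (K (card A))"
      using \<A> K spell_inject by (meson inj_onI subsetD)
    then show "card (spell n (h A) A ` K (card A)) = max_code_size (card A) (card A - t)"
      by (simp add: card_image K_card)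
  qed
  \<comment> \<open>The summand depends only on \<open>card A\<close>, so the sets are grouped by
    size; there are \<open>n choose i\<close> of size \<open>i\<close>.\<close>
  also have "\<dots> = (\<Sum>i = t + 1..n. \<Sum>A | A \<in> \<A> \<and> card A = i. max_code_size (card A) (card A - t))"
  proof (rule sum.group[symmetric, OF \<open>finite \<A>\<close>])
    show "card ` \<A> \<subseteq> {t + 1..n}"
      using card_mono[of "{..<n}"] by (fastforce simp: \<A>_def)
  qed simp
  also have "\<dots> = (\<Sum>i = t + 1..n. (n choose i) * max_code_size i (i - t))"
  proof (rule sum.cong[OF refl])
    fix i assume "i \<in> {t + 1..n}"
    then have "{A. A \<in> \<A> \<and> card A = i} = {A. A \<subseteq> {..<n} \<and> card A = i}"
      by (auto simp: \<A>_def)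
    then show "(\<Sum>A | A \<in> \<A> \<and> card A = i. max_code_size (card A) (card A - t))
        = (n choose i) * max_code_size i (i - t)"
      by (simp add: n_subsets)
  qed
  finally have S_card: "card S = (\<Sum>i = t + 1..n. (n choose i) * max_code_size i (i - t))" .
  have "\<not> contains_proper_AP (Zmod_power 4 n) 3 S"
  proof
    assume "contains_proper_AP (Zmod_power 4 n) 3 S"
    then obtain x y z d where xyz: "x \<in> S" "y \<in> S" "z \<in> S" "x \<noteq> z"
      and y: "\<And>i. i < n \<Longrightarrow> y i = (x i + d i) mod 4"
      and z: "\<And>i. i < n \<Longrightarrow> z i = (x i + 2 * d i) mod 4"
      using contains_proper_3_AP_Zmod4E by metis
    let ?odd = "\<lambda>v :: nat \<Rightarrow> int. {i. i < n \<and> odd (v i)}"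
    let ?D = "{i. i < n \<and> x i \<noteq> z i}"
    \<comment> \<open>The set from which a member of \<open>S\<close> is spelled is its own odd
      support, so it can be named without a further witness.\<close>
    have spelled: "\<exists>c. ?odd v \<in> \<A> \<and> c \<in> K (card (?odd v)) \<and> v = spell n (h (?odd v)) (?odd v) c"
      if v: "v \<in> S" for v
    proof -
      obtain A c where Ac: "A \<in> \<A>" "c \<in> K (card A)" "v = spell n (h A) A c"
        using v unfolding S_def by blast
      have "?odd v = A"
        unfolding Ac(3) by (rule odd_support_spell[OF \<A>(1)[OF Ac(1)]])
      with Ac show ?thesis
        by metis
    qed
    define A where "A = ?odd x"
    \<comment> \<open>Adding 2d preserves parity, so \<open>x\<close> and \<open>z\<close> are
      spelled along the same \<open>A\<close> from words of the same code.\<close>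
    have "odd (x i) \<longleftrightarrow> odd (z i)" if "i < n" for i
      using z[OF that] by presburger
    then have "?odd z = A"
      by (auto simp: A_def)
    then obtain c where c: "c \<in> K (card A)" "z = spell n (h A) A c"
      using spelled[OF xyz(3)] by auto
    obtain a where A: "A \<in> \<A>" and a: "a \<in> K (card A)" "x = spell n (h A) A a"
      using spelled[OF xyz(1)] unfolding A_def[symmetric] by blast
    have D_sub: "?D \<subseteq> A"
      by (auto simp: a(2) c(2) spell_def)
    \<comment> \<open>The words \<open>a\<close> and \<open>c\<close> are distinct because
      \<open>x \<noteq> z\<close>, so the distance of the code applies.\<close>
    have "card A - t \<le> hamming_dist (card A) a c"
      using K_dist a c xyz(4) by blast
    also have "\<dots> = card ?D"
      using card_spell_diff[OF \<A>(1)[OF A] \<A>(3)[OF A]] by (simp add: a(2) c(2))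
    finally have "card A - t \<le> card ?D" .
    moreover have "?odd y = A - ?D"
      unfolding A_def
    proof (rule odd_support_midpoint[where d = d])
      show "x i \<in> {0..<4}" if "i < n" for i
        using xyz(1) S_sub that by (auto simp: carrier_Zmod_power PiE_iff subset_iff)
    qed (use y z D_sub in \<open>auto simp: A_def\<close>)
    then have "card (?odd y) = card A - card ?D"
      using D_sub by (simp add: card_Diff_subset)
    moreover have "t < card (?odd y)"
      using spelled[OF xyz(2)] \<A>(2) by blast
    ultimately show False
      by linarith
  qed
  then show ?thesis
    using card_le_AP_free_max[OF _ S_sub] S_card by simp
qed

theorem theorem3p2:
  fixes n :: nat
  assumes "n > 1"
  shows "AP_free_max 3 4 n \<ge>
    Max ((\<lambda>t. \<Sum>i = t + 1..n. (n choose i) * max_code_size i (i - t)) ` {0..n})"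
  by (rule Max.boundedI) (use AP_free_max_3_4_ge in auto)

end
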